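(* Let $m\ge2$, $A>0$, $v>0$, let $D_0$ be a constant symmetric positive-definite $m\times m$ matrix, and consider the log-OU texture model with coherent modulation $a(x)=\sqrt x$ and fixed-shape fast covariance $D(x)=d(x)D_0$, $d(x)>0$. Then, for $y\in\mathbb R^m$, $y\neq0$, the generalized spectral gap is $$\Delta(x;y)=\frac{Av}{2}\,y^\top D_0^{-1}y ,$$ and is therefore constant (in $x$) along each non-zero observation fibre. The texture $x$ cannot be recovered from the gap alone.
   Context: Log-OU texture: $x=e^{R-v/2}$, where $R$ is an Ornstein–Uhlenbeck process with stationary variance $v$, and the squared diffusion coefficient in the $x$-coordinate is $\sigma_x^2(x)=2Av\,x^2$ for $x>0$. The observation is $Y=a(x)Z$ with $a(x)=\sqrt x$, where the fast variable $Z\in\mathbb R^m$ has diffusion covariance $D(x)=d(x)D_0$ and no cross quadratic variation with $x$. On the observation fibre $\{(x,y/\sqrt x):x>0\}$ the quadratic-covariation density of $Y$ is $Q(x,y)=s(x)D_0+q(x)yy^\top$ with $s(x)=a(x)^2d(x)$ and $q(x)=\sigma_x^2(x)\,(a'(x)/a(x))^2$. The generalized spectral gap $\Delta(x;y)=\lambda_\parallel-\lambda_\perp$ is the difference, for the problem $Qw=\lambda D_0w$, between the generalized eigenvalue $\lambda_\parallel$ with eigenvector $D_0^{-1}y$ and the generalized eigenvalue $\lambda_\perp$ of the vectors $w$ with $w^\top y=0$. *)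

theory Defs
  imports "HOL-Analysis.Analysis"
begin

definition sym_pos_def :: "real^'m^'m \<Rightarrow> bool" where
  "sym_pos_def D \<longleftrightarrow> transpose D = D \<and> (\<forall>w. w \<noteq> 0 \<longrightarrow> w \<bullet> (D *v w) > 0)"


section \<open>Texture and observation\<close>

text \<open>The texture as a function of the Ornstein--Uhlenbeck state
  \<open>dR = - A R dt + sqrt (2 A v) dB\<close>, whose stationary variance is \<open>v\<close>.\<close>

definition logou_texture :: "real \<Rightarrow> real \<Rightarrow> real" where
  "logou_texture v r = exp (r - v / 2)"

definition logou_sqdiff :: "real \<Rightarrow> real \<Rightarrow> real \<Rightarrow> real" where
  "logou_sqdiff A v x = 2 * A * v * x\<^sup>2"

text \<open>Ito's formula: the squared diffusion coefficient \<open>2 A v\<close> of \<open>R\<close> is multiplied by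
  \<open>(dx/dR)\<^sup>2\<close>.\<close>

lemma logou_sqdiff_texture:
  "logou_sqdiff A v (logou_texture v r) = (deriv (logou_texture v) r)\<^sup>2 * (2 * A * v)"
proof -
  have "(logou_texture v has_field_derivative logou_texture v r) (at r)"
    unfolding logou_texture_def by (auto intro!: derivative_eq_intros)
  then show ?thesis
    by (simp add: DERIV_imp_deriv logou_sqdiff_def)
qed

text \<open>The states \<open>(x, z)\<close> with \<open>x > 0\<close> and \<open>a x *\<^sub>R z = y\<close>, for a modulation \<open>a\<close> without zeros
  on the positive half-line.\<close>

definition obs_fibre :: "(real \<Rightarrow> real) \<Rightarrow> real^'m \<Rightarrow> (real \<times> (real^'m)) set" where
  "obs_fibre a y = {(x, y /\<^sub>R a x) | x. x > 0}"

text \<open>The quadratic-covariation density \<open>s(x) D\<^sub>0 + q(x) y y\<^sup>T\<close> of \<open>Y = a(x) Z\<close> at the fibre point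
  over \<open>x\<close>, where \<open>sig2\<close> is the squared diffusion coefficient of \<open>x\<close>, and \<open>Z\<close> has diffusion
  covariance \<open>d(x) D\<^sub>0\<close>.\<close>

definition obs_qcov ::
  "(real \<Rightarrow> real) \<Rightarrow> (real \<Rightarrow> real) \<Rightarrow> (real \<Rightarrow> real) \<Rightarrow> real^'m^'m \<Rightarrow> real \<Rightarrow> real^'m \<Rightarrow> real^'m^'m"
  where
  "obs_qcov a sig2 d D0 x y =
     ((a x)\<^sup>2 * d x) *\<^sub>R D0 +
     (sig2 x * (deriv a x / a x)\<^sup>2) *\<^sub>R (\<chi> i j. y $ i * y $ j)"

text \<open>Agreement with Ito's formula for the scalar observation \<open>u \<bullet> Y\<close>, whose gradient at
  \<open>(x, z)\<close> has the \<open>x\<close>-component below and the \<open>z\<close>-component \<open>a x *\<^sub>R u\<close>; there is no mixed term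
  because \<open>x\<close> and \<open>Z\<close> have no cross variation.\<close>

lemma obs_qcov_ito:
  fixes D0 :: "real^'m^'m" and u y z :: "real^'m"
  assumes "(x, z) \<in> obs_fibre a y" and "a field_differentiable at x" and "a x \<noteq> 0"
  shows "u \<bullet> (obs_qcov a sig2 d D0 x y *v u) =
    sig2 x * (deriv (\<lambda>t. u \<bullet> (a t *\<^sub>R z)) x)\<^sup>2 +
    (a x *\<^sub>R u) \<bullet> ((d x *\<^sub>R D0) *v (a x *\<^sub>R u))"
proof -
  have y: "y = a x *\<^sub>R z"
    using assms by (auto simp: obs_fibre_def)
  have "(a has_field_derivative deriv a x) (at x)"
    using assms(2) by (simp add: DERIV_deriv_iff_field_differentiable)
  then have "((\<lambda>t. u \<bullet> (a t *\<^sub>R z)) has_field_derivative deriv a x * (u \<bullet> z)) (at x)"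
    by (auto intro!: derivative_eq_intros)
  then have 1: "deriv (\<lambda>t. u \<bullet> (a t *\<^sub>R z)) x = deriv a x * (u \<bullet> z)"
    by (rule DERIV_imp_deriv)
  have 2: "(\<chi> i j. y $ i * y $ j) *v u = (y \<bullet> u) *\<^sub>R y"
    by (simp add: vec_eq_iff matrix_vector_mult_def
        inner_vec_def sum_distrib_left sum_distrib_right mult_ac)
  have "u \<bullet> (obs_qcov a sig2 d D0 x y *v u) =
      (a x)\<^sup>2 * d x * (u \<bullet> (D0 *v u)) + sig2 x * (deriv a x / a x)\<^sup>2 * (u \<bullet> y)\<^sup>2"
    unfolding obs_qcov_def
    by (simp add: matrix_vector_mult_add_rdistrib scaleR_matrix_vector_assoc [symmetric] 2
        inner_add_right inner_commute power2_eq_square mult_ac)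
  also have "\<dots> = sig2 x * (deriv a x * (u \<bullet> z))\<^sup>2 + (a x)\<^sup>2 * d x * (u \<bullet> (D0 *v u))"
    using assms(3) by (simp add: y power_mult_distrib power_divide)
  finally show ?thesis
    unfolding 1
    by (simp add: matrix_vector_mult_scaleR scaleR_matrix_vector_assoc [symmetric]
        power2_eq_square mult_ac)
qed


section \<open>Generalized eigenvalues and the gap\<close>

definition gen_eigenpair :: "real^'m^'m \<Rightarrow> real^'m^'m \<Rightarrow> real \<Rightarrow> real^'m \<Rightarrow> bool" where
  "gen_eigenpair Q D l w \<longleftrightarrow> w \<noteq> 0 \<and> Q *v w = l *\<^sub>R (D *v w)"

definition is_lambda_par :: "real^'m^'m \<Rightarrow> real^'m^'m \<Rightarrow> real^'m \<Rightarrow> real \<Rightarrow> bool" where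
  "is_lambda_par Q D y l \<longleftrightarrow> gen_eigenpair Q D l (matrix_inv D *v y)"

definition is_lambda_perp :: "real^'m^'m \<Rightarrow> real^'m^'m \<Rightarrow> real^'m \<Rightarrow> real \<Rightarrow> bool" where
  "is_lambda_perp Q D y l \<longleftrightarrow> (\<forall>w. w \<noteq> 0 \<and> w \<bullet> y = 0 \<longrightarrow> gen_eigenpair Q D l w)"

text \<open>The descriptions are meaningful only where the two eigenvalues exist and are unique;
  for \<open>y \<noteq> 0\<close>, uniqueness of the second one requires dimension at least two.\<close>

definition gen_gap :: "real^'m^'m \<Rightarrow> real^'m^'m \<Rightarrow> real^'m \<Rightarrow> real" where
  "gen_gap Q D y = (THE l. is_lambda_par Q D y l) - (THE l. is_lambda_perp Q D y l)"

definition logou_qcov ::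
  "real \<Rightarrow> real \<Rightarrow> (real \<Rightarrow> real) \<Rightarrow> real^'m^'m \<Rightarrow> real \<Rightarrow> real^'m \<Rightarrow> real^'m^'m" where
  "logou_qcov A v = obs_qcov sqrt (logou_sqdiff A v)"

definition logou_gap ::
  "real \<Rightarrow> real \<Rightarrow> (real \<Rightarrow> real) \<Rightarrow> real^'m^'m \<Rightarrow> real \<Rightarrow> real^'m \<Rightarrow> real" where
  "logou_gap A v d D0 x y = gen_gap (logou_qcov A v d D0 x y) D0 y"

end

theory Submission
  imports Defs
begin

text \<open>The quadratic covariation on a fibre is a rank-one perturbation \<open>s D\<^sub>0 + q y y\<^sup>T\<close> of a
  multiple of \<open>D\<^sub>0\<close>. Relative to \<open>D\<^sub>0\<close>, the rank-one term vanishes on the vectors orthogonal to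
  \<open>y\<close>, and it shifts the eigenvalue on \<open>D\<^sub>0\<^sup>-\<^sup>1 y\<close> by \<open>q\<close> times \<open>y\<^sup>T D\<^sub>0\<^sup>-\<^sup>1 y\<close>. So the gap is
  this shift, and \<open>s\<close> drops out of the difference (\<open>gen_gap_rank_one\<close>).

  For the square-root modulation, \<open>a'(x) / a(x) = 1 / (2 x)\<close>, while the squared diffusion
  coefficient of the log-OU texture is \<open>2 A v x\<^sup>2\<close>. The powers of \<open>x\<close> cancel and leave the
  constant \<open>q = A v / 2\<close> (\<open>logou_qcov_eq\<close>). A fibre meets every \<open>x > 0\<close>, so a function that is
  constant on it cannot determine \<open>x\<close>.\<close>

lemma sym_pos_def_invertible:
  fixes D :: "real^'m^'m"
  assumes "sym_pos_def D"
  shows "invertible D"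
proof -
  have "w = 0" if "D *v w = 0" for w
    using assms that by (metis inner_zero_right less_irrefl sym_pos_def_def)
  then show ?thesis
    by (simp add: invertible_left_inverse matrix_left_invertible_ker)
qed

lemma outer_product_mult_vec:
  fixes y w :: "real^'m"
  shows "(\<chi> i j. y $ i * y $ j) *v w = (y \<bullet> w) *\<^sub>R y"
  by (simp add: vec_eq_iff matrix_vector_mult_def inner_vec_def sum_distrib_left mult_ac)

lemma rank_one_perturbation_mult_vec:
  fixes D :: "real^'m^'m" and y w :: "real^'m"
  shows "(s *\<^sub>R D + q *\<^sub>R (\<chi> i j. y $ i * y $ j)) *v w = s *\<^sub>R (D *v w) + (q * (y \<bullet> w)) *\<^sub>R y"
  by (simp add: matrix_vector_mult_add_rdistrib scaleR_matrix_vector_assoc [symmetric]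
      outer_product_mult_vec)

text \<open>On \<open>w = D\<^sup>-\<^sup>1 y\<close> both \<open>D w\<close> and \<open>y (y\<^sup>T w)\<close> are multiples of \<open>y\<close>, so the eigenvalue
  equation reduces to a comparison of the coefficients of \<open>y\<close>.\<close>

lemma is_lambda_par_rank_one_iff:
  fixes D :: "real^'m^'m" and y :: "real^'m"
  assumes "invertible D" and "y \<noteq> 0"
  shows "is_lambda_par (s *\<^sub>R D + q *\<^sub>R (\<chi> i j. y $ i * y $ j)) D y l
    \<longleftrightarrow> l = s + q * (y \<bullet> (matrix_inv D *v y))"
proof -
  let ?w = "matrix_inv D *v y"
  have Dw: "D *v ?w = y"
  proof -
    have "D ** matrix_inv D = mat 1"
      using assms(1) unfolding invertible_def matrix_inv_def by (rule someI2_ex) blast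
    then show ?thesis
      by (simp add: matrix_vector_mul_assoc)
  qed
  then have "?w \<noteq> 0"
    using assms(2) by auto
  then have "is_lambda_par (s *\<^sub>R D + q *\<^sub>R (\<chi> i j. y $ i * y $ j)) D y l
      \<longleftrightarrow> (s + q * (y \<bullet> ?w)) *\<^sub>R y = l *\<^sub>R y"
    by (simp add: is_lambda_par_def gen_eigenpair_def rank_one_perturbation_mult_vec Dw
        scaleR_add_left)
  then show ?thesis
    using assms(2) by auto
qed

text \<open>The rank-one term kills every vector orthogonal to \<open>y\<close>. The dimension bound supplies a
  non-zero such vector, without which every \<open>l\<close> would qualify vacuously.\<close>

lemma is_lambda_perp_rank_one_iff:
  fixes D :: "real^'m^'m" and y :: "real^'m"
  assumes "CARD('m) \<ge> 2" and "invertible D"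
  shows "is_lambda_perp (s *\<^sub>R D + q *\<^sub>R (\<chi> i j. y $ i * y $ j)) D y l \<longleftrightarrow> l = s"
proof
  assume perp: "is_lambda_perp (s *\<^sub>R D + q *\<^sub>R (\<chi> i j. y $ i * y $ j)) D y l"
  have "2 \<le> DIM(real^'m)"
    using assms(1) by simp
  then obtain w where w: "w \<noteq> 0" "orthogonal y w"
    using orthogonal_to_vector_exists by metis
  then have "s *\<^sub>R (D *v w) = l *\<^sub>R (D *v w)"
    using perp by (auto simp: is_lambda_perp_def gen_eigenpair_def rank_one_perturbation_mult_vec
        orthogonal_def inner_commute)
  moreover have "D *v w \<noteq> 0"
    using w(1) assms(2) by (metis invertible_left_inverse matrix_left_invertible_ker)
  ultimately show "l = s"
    by simp
next
  assume "l = s"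
  then show "is_lambda_perp (s *\<^sub>R D + q *\<^sub>R (\<chi> i j. y $ i * y $ j)) D y l"
    by (auto simp: is_lambda_perp_def gen_eigenpair_def rank_one_perturbation_mult_vec
        inner_commute)
qed

lemma gen_gap_rank_one:
  fixes D :: "real^'m^'m" and y :: "real^'m"
  assumes "CARD('m) \<ge> 2" and "invertible D" and "y \<noteq> 0"
  shows "gen_gap (s *\<^sub>R D + q *\<^sub>R (\<chi> i j. y $ i * y $ j)) D y = q * (y \<bullet> (matrix_inv D *v y))"
  using assms by (simp add: gen_gap_def is_lambda_par_rank_one_iff is_lambda_perp_rank_one_iff)

text \<open>The linear texture noise \<open>\<sigma>\<^sub>x\<^sup>2 \<sim> x\<^sup>2\<close> is exactly compensated by the logarithmic derivative
  of a power of \<open>x\<close>; here the exponent \<open>1/2\<close> gives the factor \<open>1/4\<close>.\<close>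

lemma logou_qcov_eq:
  fixes D0 :: "real^'m^'m" and y :: "real^'m"
  assumes "x > 0"
  shows "logou_qcov A v d D0 x y
    = (x * d x) *\<^sub>R D0 + (A * v / 2) *\<^sub>R (\<chi> i j. y $ i * y $ j)"
proof -
  have "deriv sqrt x = inverse (sqrt x) / 2"
    using assms by (intro DERIV_imp_deriv DERIV_real_sqrt)
  then have "deriv sqrt x / sqrt x = inverse (sqrt x * sqrt x) / 2"
    by (simp only: inverse_mult_distrib) (simp only: divide_inverse mult_ac)
  then have "deriv sqrt x / sqrt x = 1 / (2 * x)"
    using assms by (simp add: inverse_eq_divide)
  then have "logou_sqdiff A v x * (deriv sqrt x / sqrt x)\<^sup>2 = 2 * A * v * x\<^sup>2 * (1 / (2 * x))\<^sup>2"
    by (simp only: logou_sqdiff_def)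
  also have "\<dots> = A * v / 2"
    using assms by (simp add: power2_eq_square)
  finally have "logou_sqdiff A v x * (deriv sqrt x / sqrt x)\<^sup>2 = A * v / 2" .
  then show ?thesis
    using assms by (simp only: logou_qcov_def obs_qcov_def) simp
qed

theorem corollary7p3:
  fixes A v :: real and d :: "real \<Rightarrow> real" and D0 :: "real^'m^'m" and y :: "real^'m"
  assumes "CARD('m) \<ge> 2" and "A > 0" and "v > 0"
    and "sym_pos_def D0"
    and "\<And>x. x > 0 \<Longrightarrow> d x > 0"
    and "y \<noteq> 0"
  shows "(\<forall>x>0. (\<exists>!l. is_lambda_par (logou_qcov A v d D0 x y) D0 y l) \<and>
                (\<exists>!l. is_lambda_perp (logou_qcov A v d D0 x y) D0 y l) \<and>
                logou_gap A v d D0 x y = A * v / 2 * (y \<bullet> (matrix_inv D0 *v y)))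
       \<and> (\<lambda>(x, z). logou_gap A v d D0 x y) constant_on obs_fibre sqrt y
       \<and> \<not> (\<exists>g :: real \<Rightarrow> real. \<forall>(x, z) \<in> obs_fibre sqrt y. g (logou_gap A v d D0 x y) = x)"
proof (intro conjI)
  have inv: "invertible D0"
    using assms(4) by (rule sym_pos_def_invertible)
  have gap: "logou_gap A v d D0 x y = A * v / 2 * (y \<bullet> (matrix_inv D0 *v y))" if "x > 0" for x
    unfolding logou_gap_def logou_qcov_eq [OF that] using assms(1) inv assms(6)
    by (rule gen_gap_rank_one)
  show "\<forall>x>0. (\<exists>!l. is_lambda_par (logou_qcov A v d D0 x y) D0 y l) \<and>
              (\<exists>!l. is_lambda_perp (logou_qcov A v d D0 x y) D0 y l) \<and>
              logou_gap A v d D0 x y = A * v / 2 * (y \<bullet> (matrix_inv D0 *v y))"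
    using assms(1,6) inv gap
    by (simp add: logou_qcov_eq is_lambda_par_rank_one_iff is_lambda_perp_rank_one_iff)
  show "(\<lambda>(x, z). logou_gap A v d D0 x y) constant_on obs_fibre sqrt y"
    unfolding constant_on_def obs_fibre_def
    by (rule exI [of _ "A * v / 2 * (y \<bullet> (matrix_inv D0 *v y))"]) (clarsimp simp only: gap prod.case)
  show "\<not> (\<exists>g :: real \<Rightarrow> real. \<forall>(x, z) \<in> obs_fibre sqrt y. g (logou_gap A v d D0 x y) = x)"
  proof
    assume "\<exists>g :: real \<Rightarrow> real. \<forall>(x, z) \<in> obs_fibre sqrt y. g (logou_gap A v d D0 x y) = x"
    then obtain g :: "real \<Rightarrow> real" where g: "g (logou_gap A v d D0 x y) = x" if "x > 0" for x
      unfolding obs_fibre_def by blast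
    have "g (logou_gap A v d D0 1 y) = g (logou_gap A v d D0 2 y)"
      by (simp add: gap)
    then show False
      by (simp add: g)
  qed
qed

end
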